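(* Let $A\in\mathbb{R}^{m\times m}$ be symmetric positive definite, let $\epsilon>0$, let $\hat\epsilon:=\dfrac{\epsilon}{\lambda_{\max}(A)}$ be the scaled precision and let $\kappa:=\dfrac{\lambda_{\max}(A)}{\lambda_{\min}(A)}$ be the condition number. If $$\hat\epsilon(1-\hat\epsilon)\ge\frac4\kappa,$$ then the complexity bound of coordinate descent with momentum is tighter than the complexity bound of coordinate descent without momentum, that is, $$4\,\frac{\mathrm{Trace}(A)}{\epsilon}\le\frac{\mathrm{Trace}(A)}{\lambda_{\min}(A)}\log\left(\frac{\lambda_{\max}(A)}{\epsilon}\right).$$ Furthermore, if $\kappa\ge 16$, the solutions in $\hat\epsilon$ of $\hat\epsilon(1-\hat\epsilon)\ge\frac4\kappa$ are given by $$\frac12-\frac12\sqrt{1-\frac{16}{\kappa}}\le\hat\epsilon\le\frac12+\frac12\sqrt{1-\frac{16}{\kappa}}.$$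
   Context: $\lambda_{\min}(A)$ and $\lambda_{\max}(A)$ are the smallest and largest eigenvalues of $A$. For solving $Aw=b$ by randomized coordinate descent, where coordinate $i$ is sampled with probability $A_{ii}/\mathrm{Trace}(A)$, the two complexity bounds compared are the numbers of iterations $t$ that guarantee $\mathbb{E}[\|Aw^t-b\|^2]/\|w^0-w^*\|_A^2<\epsilon$: with (iteration-dependent) momentum, $t\ge 4\,\mathrm{Trace}(A)/\epsilon$; without momentum, $t\ge\frac{\mathrm{Trace}(A)}{\lambda_{\min}(A)}\log\left(\frac{\lambda_{\max}(A)}{\epsilon}\right)$. *)

theory Defs
  imports Complex_Main "Jordan_Normal_Form.Spectral_Radius"
begin

definition sym_pos_def :: "nat \<Rightarrow> real mat \<Rightarrow> bool" where
  "sym_pos_def m A \<longleftrightarrow>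
     A \<in> carrier_mat m m \<and> transpose_mat A = A \<and>
     (\<forall>v \<in> carrier_vec m. v \<noteq> 0\<^sub>v m \<longrightarrow> v \<bullet> (A *\<^sub>v v) > 0)"

text \<open>
  The spectrum below is the set of real eigenvalues. It is always finite, and for a symmetric
  matrix of positive dimension it is nonempty and contains all the eigenvalues, so that the
  minimum and maximum are meaningful there.
\<close>

definition lambda_min :: "real mat \<Rightarrow> real" where
  "lambda_min A = Min (spectrum A)"

definition lambda_max :: "real mat \<Rightarrow> real" where
  "lambda_max A = Max (spectrum A)"

definition condition_number :: "real mat \<Rightarrow> real" where
  "condition_number A = lambda_max A / lambda_min A"

definition mat_trace :: "real mat \<Rightarrow> real" where
  "mat_trace A = (\<Sum>i<dim_row A. A $$ (i, i))"

text \<open>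
  Randomized coordinate descent for \<open>A w = b\<close> samples coordinate \<open>i\<close> with probability
  \<open>A\<^sub>i\<^sub>i / Trace A\<close>. The two quantities below are the lower bounds on the number \<open>t\<close> of
  iterations which guarantee that the expectation of \<open>\<parallel>A w\<^sup>t - b\<parallel>\<^sup>2\<close>, divided by the squared
  \<open>A\<close>-norm of \<open>w\<^sup>0 - w\<^sup>*\<close>, is smaller than \<open>\<epsilon>\<close>: with iteration-dependent momentum,
  and without momentum.
\<close>

definition cd_momentum_bound :: "real mat \<Rightarrow> real \<Rightarrow> real" where
  "cd_momentum_bound A \<epsilon> = 4 * (mat_trace A / \<epsilon>)"

definition cd_bound :: "real mat \<Rightarrow> real \<Rightarrow> real" where
  "cd_bound A \<epsilon> = mat_trace A / lambda_min A * ln (lambda_max A / \<epsilon>)"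

end

theory Submission
  imports Defs
begin

text \<open>
  Put \<open>x = \<epsilon> / lambda_max A\<close>. Since \<open>ln (1 / x) \<ge> 1 - x\<close>, the logarithmic factor of the bound
  without momentum is at least \<open>1 - x\<close>, and the hypothesis \<open>x (1 - x) \<ge> 4 / \<kappa>\<close>, multiplied by
  \<open>lambda_max A / \<epsilon>\<close>, says that \<open>1 - x \<ge> 4 lambda_min A / \<epsilon>\<close>. The extreme
  eigenvalues exist because a real symmetric matrix has a real eigenvalue: by symmetry, every
  eigenvalue of its complexification is fixed by conjugation.
\<close>

text \<open>Moving the symmetric matrix from one factor of \<open>v \<bullet>c v\<close> to the
  other evaluates the same number as \<open>z\<close> and as \<open>cnj z\<close> times
  \<open>v \<bullet>c v\<close>, which is nonzero for an eigenvector.\<close>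

lemma transpose_self_complex_eigenvalue_real:
  fixes A :: "real mat"
  assumes A: "A \<in> carrier_mat n n" and sym: "transpose_mat A = A"
    and z: "eigenvalue (map_mat complex_of_real A) z"
  shows "z \<in> \<real>"
proof -
  let ?B = "map_mat complex_of_real A"
  have B: "?B \<in> carrier_mat n n" using A by simp
  have symB: "transpose_mat ?B = ?B" by (metis sym map_mat_transpose)
  from z B obtain v where v: "v \<in> carrier_vec n" "v \<noteq> 0\<^sub>v n" "?B *\<^sub>v v = z \<cdot>\<^sub>v v"
    unfolding eigenvalue_def eigenvector_def by auto
  have cv: "conjugate v \<in> carrier_vec n" using v(1) by simp
  \<comment> \<open>The entries of \<open>?B\<close> are real, so conjugation commutes with it and
    turns \<open>v\<close> into an eigenvector for \<open>cnj z\<close>.\<close>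
  have "?B *\<^sub>v conjugate v = conjugate (?B *\<^sub>v v)"
    using A v(1) by (intro eq_vecI) (auto simp: scalar_prod_def sum_conjugate)
  then have Bcv: "?B *\<^sub>v conjugate v = cnj z \<cdot>\<^sub>v conjugate v"
    by (simp add: v(3) conjugate_smult_vec)
  have "z * (v \<bullet>c v) = (transpose_mat ?B *\<^sub>v v) \<bullet>c v"
    using v(1) cv by (simp add: symB v(3))
  also have "\<dots> = v \<bullet> (?B *\<^sub>v conjugate v)"
    by (rule transpose_vec_mult_scalar[OF B cv v(1)])
  also have "\<dots> = cnj z * (v \<bullet>c v)"
    using v(1) cv by (simp add: Bcv)
  finally have "z = cnj z"
    using conjugate_square_eq_0_vec[OF v(1)] v(2) by simp
  then show ?thesis by (simp add: Reals_cnj_iff)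
qed

text \<open>A complex eigenvalue exists and is real; complexification maps the characteristic
  polynomial coefficientwise, so this number is already a root of the real one.\<close>

lemma transpose_self_spectrum_non_empty:
  fixes A :: "real mat"
  assumes A: "A \<in> carrier_mat n n" and sym: "transpose_mat A = A" and n: "n > 0"
  shows "spectrum A \<noteq> {}"
proof -
  let ?B = "map_mat complex_of_real A"
  have B: "?B \<in> carrier_mat n n" using A by simp
  obtain z where z: "eigenvalue ?B z"
    using spectrum_non_empty[OF B n] by (auto simp: spectrum_def)
  then obtain x where x: "z = complex_of_real x"
    using transpose_self_complex_eigenvalue_real[OF A sym] by (auto elim: Reals_cases)
  have "poly (map_poly complex_of_real (char_poly A)) (complex_of_real x) = 0"
    using z unfolding eigenvalue_root_char_poly[OF B] of_real_hom.char_poly_hom[OF A] x .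
  then have "poly (char_poly A) x = 0" by simp
  then show ?thesis
    using eigenvalue_root_char_poly[OF A] by (auto simp: spectrum_def)
qed

lemma sym_pos_def_eigenvalue_pos:
  assumes "sym_pos_def m A" and "k \<in> spectrum A"
  shows "k > 0"
proof -
  from assms obtain v where v: "v \<in> carrier_vec m" "v \<noteq> 0\<^sub>v m" "A *\<^sub>v v = k \<cdot>\<^sub>v v"
    unfolding sym_pos_def_def spectrum_def eigenvalue_def eigenvector_def by auto
  have "0 < v \<bullet> (A *\<^sub>v v)" using assms(1) v unfolding sym_pos_def_def by blast
  also have "\<dots> = k * (v \<bullet> v)" using v by simp
  \<comment> \<open>Since \<open>v \<bullet> v\<close> is nonnegative, the positive product cannot
    have two negative factors.\<close>
  finally show ?thesis
    using conjugate_square_ge_0_vec[of v] by (auto simp: zero_less_mult_iff)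
qed

text \<open>Each diagonal entry is the quadratic form at a unit vector.\<close>

lemma sym_pos_def_trace_nonneg:
  assumes "sym_pos_def m A"
  shows "mat_trace A \<ge> 0"
proof -
  have A: "A \<in> carrier_mat m m" using assms unfolding sym_pos_def_def by blast
  have "A $$ (i, i) \<ge> 0" if i: "i < m" for i
  proof -
    have "unit_vec m i \<noteq> (0\<^sub>v m :: real vec)"
      using i by (metis index_unit_vec(2) index_zero_vec(1) zero_neq_one)
    then have "0 < unit_vec m i \<bullet> (A *\<^sub>v unit_vec m i)"
      using assms unfolding sym_pos_def_def by simp
    also have "\<dots> = A $$ (i, i)"
      using A i by (simp add: mult_mat_vec_def)
    finally show ?thesis by simp
  qed
  then show ?thesis using A by (auto simp: mat_trace_def intro: sum_nonneg)
qed

text \<open>Completing the square: \<open>1 - 4 * x * (1 - x)\<close> equals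
  \<open>(2 * x - 1)\<^sup>2\<close>.\<close>

lemma mult_one_minus_ge_iff:
  fixes c x :: real
  shows "c \<le> x * (1 - x) \<longleftrightarrow>
    1 / 2 - 1 / 2 * sqrt (1 - 4 * c) \<le> x \<and> x \<le> 1 / 2 + 1 / 2 * sqrt (1 - 4 * c)"
proof -
  have "c \<le> x * (1 - x) \<longleftrightarrow> (2 * x - 1)\<^sup>2 \<le> 1 - 4 * c"
    by (auto simp: power2_eq_square algebra_simps)
  \<comment> \<open>\<open>sqrt\<close> is strictly increasing on all reals and negative at negative
    arguments, so for \<open>4 * c > 1\<close> both sides are false.\<close>
  also have "\<dots> \<longleftrightarrow> \<bar>2 * x - 1\<bar> \<le> sqrt (1 - 4 * c)"
    by (metis real_sqrt_abs real_sqrt_le_iff)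
  finally show ?thesis by (auto simp: abs_le_iff)
qed

theorem corollary7p3:
  fixes m :: nat and A :: "real mat" and \<epsilon> \<epsilon>_hat \<kappa> :: real
  assumes "m \<ge> 1"
    and "sym_pos_def m A"
    and "\<epsilon> > 0"
    and "\<epsilon>_hat = \<epsilon> / lambda_max A"
    and "\<kappa> = condition_number A"
  shows "(\<epsilon>_hat * (1 - \<epsilon>_hat) \<ge> 4 / \<kappa> \<longrightarrow> cd_momentum_bound A \<epsilon> \<le> cd_bound A \<epsilon>) \<and>
    (\<kappa> \<ge> 16 \<longrightarrow>
      (\<forall>x::real. x * (1 - x) \<ge> 4 / \<kappa> \<longleftrightarrow>
        1 / 2 - 1 / 2 * sqrt (1 - 16 / \<kappa>) \<le> x \<and> x \<le> 1 / 2 + 1 / 2 * sqrt (1 - 16 / \<kappa>)))"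
proof (intro conjI impI allI)
  have A: "A \<in> carrier_mat m m" "transpose_mat A = A"
    using assms(2) unfolding sym_pos_def_def by auto
  have ne: "spectrum A \<noteq> {}"
    using transpose_self_spectrum_non_empty[OF A] assms(1) by simp
  have fin: "finite (spectrum A)" by (rule card_finite_spectrum(1)[OF A(1)])
  define l L where "l = lambda_min A" and "L = lambda_max A"
  have l: "l > 0" and L: "L > 0"
    using sym_pos_def_eigenvalue_pos[OF assms(2)] Min_in[OF fin ne] Max_in[OF fin ne]
    by (auto simp: l_def L_def lambda_min_def lambda_max_def)
  assume "4 / \<kappa> \<le> \<epsilon>_hat * (1 - \<epsilon>_hat)"
  then have "4 * l / L \<le> \<epsilon> / L * (1 - \<epsilon> / L)"
    by (simp add: assms(4,5) condition_number_def l_def L_def)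
  then have "4 * l \<le> \<epsilon> * (1 - \<epsilon> / L)"
    using L by (simp add: divide_le_cancel)
  then have "4 * l / \<epsilon> \<le> 1 - \<epsilon> / L"
    using assms(3) by (simp add: pos_divide_le_eq mult.commute)
  \<comment> \<open>This is \<open>ln y \<le> y - 1\<close> at \<open>y = \<epsilon> / L\<close>,
    negated.\<close>
  also have "\<dots> \<le> ln (L / \<epsilon>)"
    using ln_le_minus_one[of "\<epsilon> / L"] L assms(3) by (simp add: ln_div)
  \<comment> \<open>The nonnegative factor \<open>mat_trace A / l\<close> turns the two sides into
    the two complexity bounds.\<close>
  finally have "mat_trace A / l * (4 * l / \<epsilon>) \<le> mat_trace A / l * ln (L / \<epsilon>)"
    using sym_pos_def_trace_nonneg[OF assms(2)] l by (intro mult_left_mono) auto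
  then show "cd_momentum_bound A \<epsilon> \<le> cd_bound A \<epsilon>"
    using l by (simp add: cd_momentum_bound_def cd_bound_def l_def L_def mult.commute)
next
  fix x :: real
  show "4 / \<kappa> \<le> x * (1 - x) \<longleftrightarrow>
    1 / 2 - 1 / 2 * sqrt (1 - 16 / \<kappa>) \<le> x \<and> x \<le> 1 / 2 + 1 / 2 * sqrt (1 - 16 / \<kappa>)"
    using mult_one_minus_ge_iff[of "4 / \<kappa>" x] by simp
qed

end
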